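(* Let $\Gamma$, $C=(c_{ij})_{i,j\in I}$ be associated to a Coxeter group $W$ as described in the context, and assume that $c_{ij}=c_{ji}$ whenever $n_{ij}$ is odd (and finite). Let $v\in\mathbb{R}^I$. Then $v$ is winning (for the numbers game with a cutoff) if and only if the usual numbers game starting at $v$ terminates and $$\alpha\cdot v\ge-1\quad\text{for all }\alpha\in\Delta_+.$$ Moreover, if this inequality condition is not satisfied and the usual numbers game starting at $v$ terminates, then $v$ is losing.
   Context: Setting: $\Gamma$ is a finite graph with vertex set $I$, without loops or multiple edges. $W$ is the Coxeter group with generators $s_i$ ($i\in I$) and relations $(s_is_j)^{n_{ij}}=1$, where $n_{ii}=1$, $n_{ij}=n_{ji}\in\{2,3,\dots\}\cup\{\infty\}$ for $i\ne j$ (no relation if $n_{ij}=\infty$), and distinct $i,j$ are adjacent in $\Gamma$ exactly when $n_{ij}\geq3$. $C=(c_{ij})$ is a real matrix with $c_{ii}=2$ for all $i$, $c_{ij}=0$ whenever $i\ne j$ are not adjacent, and for adjacent $i,j$: $c_{ij},c_{ji}<0$ and either $c_{ij}c_{ji}=4\cos^2(\pi/n_{ij})$ if $n_{ij}$ is finite, or $c_{ij}c_{ji}\ge4$ if $n_{ij}=\infty$. Usual (weighted) numbers game: configurations are $v\in\mathbb{R}^I$; if $v_i<0$ one may fire $i$, replacing $v$ by $f_i(v)$ with $f_i(v)_j=v_j-c_{ij}v_i$. The game terminates when all entries are nonnegative. (It is known that if the game from $v$ can terminate, then it must terminate, in the same number of moves and at the same configuration, however it is played.) Numbers game with a cutoff: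 the same moves, but a configuration is forbidden if some $v_i<-1$ (allowed otherwise), and the game ends upon reaching (or starting at) a forbidden configuration. A configuration is winning if it is possible, playing the game with a cutoff, to reach a configuration with all entries nonnegative; it is losing if, no matter how the game with a cutoff is played, one reaches a forbidden configuration. $W$ acts on $\mathbb{R}^I$ (basis of elementary vectors $\alpha_i$, the simple roots) by $s_i(\beta)_j=\beta_j$ for $j\ne i$ and $s_i(\beta)_i=-\beta_i-\sum_{k\ne i}c_{ik}\beta_k$. The set of (real) roots is $\Delta=\bigcup_{i\in I}W\alpha_i$, and $\Delta_+$ is the set of roots all of whose entries are nonnegative. The symbol $\cdot$ is the standard dot product on $\mathbb{R}^I$. *)

theory Defs
  imports "HOL-Analysis.Analysis" "HOL-Algebra.Group_Action"
begin

section \<open>Coxeter groups\<close>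

text \<open>A Coxeter graph: vertices are the elements of the finite type, \<open>E\<close> is the adjacency
  relation of the simple graph, \<open>n\<close> gives the exponents of the Coxeter relations.\<close>

locale coxeter_graph =
  fixes E :: "('i::finite \<times> 'i) set"
    and n :: "'i \<Rightarrow> 'i \<Rightarrow> enat"
  assumes E_sym: "sym E"
    and E_irrefl: "irrefl E"
    and n_diag: "n i i = 1"
    and n_sym: "n i j = n j i"
    and n_ge_2: "i \<noteq> j \<Longrightarrow> 2 \<le> n i j"
    and adjacent_iff: "i \<noteq> j \<Longrightarrow> (i, j) \<in> E \<longleftrightarrow> 3 \<le> n i j"

text \<open>The congruence on words in the generators generated by the Coxeter relations. Since
  \<open>n i i = 1\<close>, the relations include \<open>s\<^sub>i s\<^sub>i = 1\<close>, so that the monoid presented in this way is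
  the group with the same presentation.\<close>

inductive coxeter_eq :: "('i \<Rightarrow> 'i \<Rightarrow> enat) \<Rightarrow> 'i list \<Rightarrow> 'i list \<Rightarrow> bool"
  for n where
  rel: "n i j = enat m \<Longrightarrow>
    coxeter_eq n (u @ concat (replicate m [i, j]) @ w) (u @ w)"
| refl: "coxeter_eq n u u"
| sym: "coxeter_eq n u w \<Longrightarrow> coxeter_eq n w u"
| trans: "coxeter_eq n u w \<Longrightarrow> coxeter_eq n w x \<Longrightarrow> coxeter_eq n u x"

definition coxeter_rel :: "('i \<Rightarrow> 'i \<Rightarrow> enat) \<Rightarrow> ('i list \<times> 'i list) set" where
  "coxeter_rel n = {(u, w). coxeter_eq n u w}"

definition coxeter_group :: "('i \<Rightarrow> 'i \<Rightarrow> enat) \<Rightarrow> 'i list set monoid" where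
  "coxeter_group n =
    \<lparr>carrier = UNIV // coxeter_rel n,
     mult = (\<lambda>X Y. \<Union>u\<in>X. \<Union>w\<in>Y. coxeter_rel n `` {u @ w}),
     one = coxeter_rel n `` {[]}\<rparr>"

lemma equiv_coxeter_rel: "equiv UNIV (coxeter_rel n)"
  unfolding coxeter_rel_def
  by (intro equivI refl_onI symI transI) (auto intro: coxeter_eq.intros)

lemma coxeter_eq_append: "coxeter_eq n u w \<Longrightarrow> coxeter_eq n (x @ u @ y) (x @ w @ y)"
proof (induction rule: coxeter_eq.induct)
  case (rel i j m u w)
  then show ?case using coxeter_eq.rel[of n i j m "x @ u" "w @ y"] by simp
qed (auto intro: coxeter_eq.intros)

lemma coxeter_eq_append2:
  assumes "coxeter_eq n u u'" "coxeter_eq n w w'"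
  shows "coxeter_eq n (u @ w) (u' @ w')"
  using coxeter_eq_append[OF assms(1), of "[]" w] coxeter_eq_append[OF assms(2), of u' "[]"]
  by (auto intro: coxeter_eq.trans)

lemma coxeter_class_eq_iff:
  "coxeter_rel n `` {u} = coxeter_rel n `` {w} \<longleftrightarrow> coxeter_eq n u w"
  using eq_equiv_class_iff[OF equiv_coxeter_rel] by (auto simp: coxeter_rel_def)

lemma coxeter_group_carrier:
  "X \<in> carrier (coxeter_group n) \<longleftrightarrow> (\<exists>u. X = coxeter_rel n `` {u})"
  by (auto simp: coxeter_group_def quotient_def)

lemma coxeter_group_mult:
  "coxeter_rel n `` {u} \<otimes>\<^bsub>coxeter_group n\<^esub> coxeter_rel n `` {w} = coxeter_rel n `` {u @ w}"
proof -
  have "coxeter_rel n `` {u' @ w'} = coxeter_rel n `` {u @ w}"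
    if "u' \<in> coxeter_rel n `` {u}" "w' \<in> coxeter_rel n `` {w}" for u' w'
    using that unfolding coxeter_class_eq_iff
    by (auto simp: coxeter_rel_def intro: coxeter_eq_append2 coxeter_eq.sym)
  moreover have "u \<in> coxeter_rel n `` {u}" "w \<in> coxeter_rel n `` {w}"
    by (auto simp: coxeter_rel_def intro: coxeter_eq.refl)
  ultimately have "(\<Union>u'\<in>coxeter_rel n `` {u}. \<Union>w'\<in>coxeter_rel n `` {w}.
      coxeter_rel n `` {u' @ w'}) = coxeter_rel n `` {u @ w}"
    by blast
  then show ?thesis by (simp add: coxeter_group_def)
qed

lemma coxeter_group_one: "\<one>\<^bsub>coxeter_group n\<^esub> = coxeter_rel n `` {[]}"
  by (simp add: coxeter_group_def)

lemma (in coxeter_graph) coxeter_eq_rev: "coxeter_eq n (rev u @ u) []"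
proof (induction u)
  case Nil
  show ?case by (simp add: coxeter_eq.refl)
next
  case (Cons i u)
  have "coxeter_eq n (rev u @ [i, i] @ u) (rev u @ u)"
    using coxeter_eq.rel[of n i i 1 "rev u" u] n_diag[of i] by (simp add: one_enat_def)
  then show ?case using Cons by (auto intro: coxeter_eq.trans)
qed

theorem (in coxeter_graph) group_coxeter_group: "group (coxeter_group n)"
proof (rule groupI)
  show "\<exists>Y\<in>carrier (coxeter_group n). Y \<otimes>\<^bsub>coxeter_group n\<^esub> X = \<one>\<^bsub>coxeter_group n\<^esub>"
    if X: "X \<in> carrier (coxeter_group n)" for X
  proof -
    from X obtain u where u: "X = coxeter_rel n `` {u}"
      unfolding coxeter_group_carrier by metis
    have "coxeter_rel n `` {rev u} \<otimes>\<^bsub>coxeter_group n\<^esub> X = \<one>\<^bsub>coxeter_group n\<^esub>"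
      unfolding u coxeter_group_mult coxeter_group_one coxeter_class_eq_iff
      by (rule coxeter_eq_rev)
    then show ?thesis using coxeter_group_carrier by blast
  qed
next
  fix X Y assume "X \<in> carrier (coxeter_group n)" "Y \<in> carrier (coxeter_group n)"
  then obtain u w where "X = coxeter_rel n `` {u}" "Y = coxeter_rel n `` {w}"
    unfolding coxeter_group_carrier by metis
  then show "X \<otimes>\<^bsub>coxeter_group n\<^esub> Y \<in> carrier (coxeter_group n)"
    using coxeter_group_carrier coxeter_group_mult by metis
next
  show "\<one>\<^bsub>coxeter_group n\<^esub> \<in> carrier (coxeter_group n)"
    using coxeter_group_carrier coxeter_group_one by metis
next
  fix X Y Z
  assume "X \<in> carrier (coxeter_group n)" "Y \<in> carrier (coxeter_group n)"
    "Z \<in> carrier (coxeter_group n)"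
  then obtain u w x where "X = coxeter_rel n `` {u}" "Y = coxeter_rel n `` {w}"
    "Z = coxeter_rel n `` {x}"
    unfolding coxeter_group_carrier by metis
  then show "X \<otimes>\<^bsub>coxeter_group n\<^esub> Y \<otimes>\<^bsub>coxeter_group n\<^esub> Z
      = X \<otimes>\<^bsub>coxeter_group n\<^esub> (Y \<otimes>\<^bsub>coxeter_group n\<^esub> Z)"
    by (simp only: coxeter_group_mult append_assoc)
next
  fix X assume "X \<in> carrier (coxeter_group n)"
  then obtain u where "X = coxeter_rel n `` {u}"
    unfolding coxeter_group_carrier by metis
  then show "\<one>\<^bsub>coxeter_group n\<^esub> \<otimes>\<^bsub>coxeter_group n\<^esub> X = X"
    by (simp only: coxeter_group_one coxeter_group_mult append_Nil)
qed


section \<open>The reflection action and the roots\<close>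

locale coxeter_matrix = coxeter_graph E n
  for E :: "('i::finite \<times> 'i) set" and n :: "'i \<Rightarrow> 'i \<Rightarrow> enat" +
  fixes C :: "real^'i^'i"
  assumes C_diag: "C $ i $ i = 2"
    and C_nonadjacent: "i \<noteq> j \<Longrightarrow> (i, j) \<notin> E \<Longrightarrow> C $ i $ j = 0"
    and C_adjacent: "(i, j) \<in> E \<Longrightarrow> C $ i $ j < 0"
    and C_finite: "(i, j) \<in> E \<Longrightarrow> n i j = enat m \<Longrightarrow>
      C $ i $ j * C $ j $ i = 4 * (cos (pi / real m))\<^sup>2"
    and C_infinite: "(i, j) \<in> E \<Longrightarrow> n i j = \<infinity> \<Longrightarrow> C $ i $ j * C $ j $ i \<ge> 4"

definition simple_root :: "'i::finite \<Rightarrow> real^'i" where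
  "simple_root i = axis i 1"

definition simple_reflection :: "real^'i^'i \<Rightarrow> 'i::finite \<Rightarrow> real^'i \<Rightarrow> real^'i" where
  "simple_reflection C i \<beta> =
    (\<chi> j. if j = i then - \<beta> $ i - (\<Sum>k\<in>UNIV - {i}. C $ i $ k * \<beta> $ k) else \<beta> $ j)"

definition word_action :: "real^'i^'i \<Rightarrow> 'i::finite list \<Rightarrow> real^'i \<Rightarrow> real^'i" where
  "word_action C u = foldr (simple_reflection C) u"

text \<open>The action of an element of the Coxeter group, through a representing word. It does not
  depend on the choice of the word and is a group action: see \<open>coxeter_action_class\<close> and
  \<open>group_action_coxeter\<close> below.\<close>

definition coxeter_action :: "real^'i^'i \<Rightarrow> 'i::finite list set \<Rightarrow> real^'i \<Rightarrow> real^'i" where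
  "coxeter_action C X = word_action C (SOME u. u \<in> X)"

definition roots :: "('i \<Rightarrow> 'i \<Rightarrow> enat) \<Rightarrow> real^'i^'i \<Rightarrow> (real^'i::finite) set" where
  "roots n C = (\<Union>i. orbit (coxeter_group n) (coxeter_action C) (simple_root i))"

definition positive_roots :: "('i \<Rightarrow> 'i \<Rightarrow> enat) \<Rightarrow> real^'i^'i \<Rightarrow> (real^'i::finite) set" where
  "positive_roots n C = {\<alpha> \<in> roots n C. \<forall>i. 0 \<le> \<alpha> $ i}"

lemma word_action_simps [simp]:
  "word_action C [] \<beta> = \<beta>"
  "word_action C (i # u) \<beta> = simple_reflection C i (word_action C u \<beta>)"
  "word_action C (u @ w) \<beta> = word_action C u (word_action C w \<beta>)"
  by (simp_all add: word_action_def)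

lemma (in coxeter_matrix) simple_reflection_eq:
  "simple_reflection C i \<beta> = \<beta> - ((C *v \<beta>) $ i) *\<^sub>R simple_root i"
proof -
  have "(C *v \<beta>) $ i = 2 * \<beta> $ i + (\<Sum>k\<in>UNIV - {i}. C $ i $ k * \<beta> $ k)"
    unfolding matrix_vector_mult_def
    by (simp add: sum.remove[of UNIV i] C_diag)
  then show ?thesis
    by (auto simp: vec_eq_iff simple_reflection_def simple_root_def axis_def)
qed

lemma matrix_simple_root: "(C *v simple_root i) $ j = C $ j $ i"
  unfolding simple_root_def matrix_vector_mult_basis by (simp add: column_def)

lemma sum_sin_full_period:
  fixes \<phi> c :: real
  assumes "real N * \<phi> = 2 * pi" "sin (\<phi> / 2) \<noteq> 0"
  shows "(\<Sum>m<N. sin (real m * \<phi> + c)) = 0"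
proof -
  have step: "2 * sin (\<phi> / 2) * sin (real m * \<phi> + c)
      = cos (real m * \<phi> + c - \<phi> / 2) - cos (real (Suc m) * \<phi> + c - \<phi> / 2)" for m
  proof -
    have "real (Suc m) * \<phi> + c - \<phi> / 2 = (real m * \<phi> + c) + \<phi> / 2"
      by (simp add: field_simps)
    then show ?thesis by (simp add: cos_add cos_diff)
  qed
  have "2 * sin (\<phi> / 2) * (\<Sum>m<N. sin (real m * \<phi> + c))
      = (\<Sum>m<N. cos (real m * \<phi> + c - \<phi> / 2) - cos (real (Suc m) * \<phi> + c - \<phi> / 2))"
    by (simp only: sum_distrib_left step)
  also have "\<dots> = cos (c - \<phi> / 2) - cos (real N * \<phi> + c - \<phi> / 2)"
    using sum_lessThan_telescope'[of "\<lambda>m. cos (real m * \<phi> + c - \<phi> / 2)" N] by simp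
  also have "real N * \<phi> + c - \<phi> / 2 = (c - \<phi> / 2) + 2 * pi"
    using assms(1) by simp
  finally show ?thesis using assms(2) by (simp only: cos_periodic) simp
qed

lemma sum_recurrence_full_period:
  fixes z :: "nat \<Rightarrow> real"
  assumes z: "\<And>m. z (Suc (Suc m)) = 2 * cos \<phi> * z (Suc m) - z m"
    and "real N * \<phi> = 2 * pi" "sin (\<phi> / 2) \<noteq> 0" "sin \<phi> \<noteq> 0"
  shows "(\<Sum>m<N. z m) = 0"
proof -
  have rec: "sin \<phi> * z m = sin (real m * \<phi>) * z 1 - sin (real m * \<phi> - \<phi>) * z 0" for m
  proof (induction m rule: induct_nat_012)
    case (ge2 k)
    have a: "2 * cos \<phi> * sin (t + \<phi>) - sin t = sin (t + 2 * \<phi>)" for t :: real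
    proof -
      have "sin (t + 2 * \<phi>) = sin ((t + \<phi>) + \<phi>)" by (simp add: algebra_simps)
      moreover have "sin t = sin ((t + \<phi>) - \<phi>)" by simp
      ultimately show ?thesis by (simp only: sin_add[of "t + \<phi>"] sin_diff[of "t + \<phi>"]) simp
    qed
    have e: "real (Suc k) * \<phi> = real k * \<phi> + \<phi>" "real (Suc (Suc k)) * \<phi> = real k * \<phi> + 2 * \<phi>"
      "real (Suc k) * \<phi> - \<phi> = (real k * \<phi> - \<phi>) + \<phi>"
      "real (Suc (Suc k)) * \<phi> - \<phi> = (real k * \<phi> - \<phi>) + 2 * \<phi>"
      by (simp_all add: algebra_simps)
    have "sin \<phi> * z (Suc (Suc k)) = 2 * cos \<phi> * (sin \<phi> * z (Suc k)) - sin \<phi> * z k"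
      by (simp add: z algebra_simps)
    also have "\<dots> = (2 * cos \<phi> * sin (real k * \<phi> + \<phi>) - sin (real k * \<phi>)) * z 1
        - (2 * cos \<phi> * sin ((real k * \<phi> - \<phi>) + \<phi>) - sin (real k * \<phi> - \<phi>)) * z 0"
      unfolding ge2.IH unfolding e(3) unfolding e(1) by (simp add: ring_distribs)
    finally show ?case unfolding a unfolding e(4) unfolding e(2) .
  qed auto
  have "sin \<phi> * (\<Sum>m<N. z m)
      = (\<Sum>m<N. sin (real m * \<phi> + 0)) * z 1 - (\<Sum>m<N. sin (real m * \<phi> + - \<phi>)) * z 0"
    by (simp add: sum_distrib_left rec sum_subtractf sum_distrib_right)
  also have "\<dots> = 0"
    unfolding sum_sin_full_period[OF assms(2,3)] by simp
  finally show ?thesis using assms(4) by simp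
qed

lemma (in coxeter_matrix) word_action_relation:
  assumes m: "n i j = enat N"
  shows "word_action C (concat (replicate N [i, j])) \<beta> = \<beta>"
proof (cases "i = j")
  case True
  then have "N = 1" using m n_diag[of i] by (simp add: one_enat_def)
  then show ?thesis using True
    by (simp add: simple_reflection_eq
        matrix_simple_root C_diag algebra_simps)
next
  case False
  define a where "a = C $ i $ j"
  define b where "b = C $ j $ i"
  define v where "v = (\<lambda>k. word_action C (concat (replicate k [i, j])) \<beta>)"
  define x where "x = (\<lambda>k. (C *v v k) $ i)"
  define y where "y = (\<lambda>k. (C *v v k) $ j)"
  have v_Suc: "v (Suc k) = v k - (x k - a * y k) *\<^sub>R simple_root i - y k *\<^sub>R simple_root j" for k
    by (simp add: v_def x_def y_def a_def simple_reflection_eq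
        matrix_simple_root algebra_simps)
  have mv: "(C *v v (Suc k)) $ l = (C *v v k) $ l - (x k - a * y k) * C $ l $ i - y k * C $ l $ j"
    for k l
    unfolding v_Suc
    by (simp add: matrix_vector_mult_diff_distrib matrix_vector_mult_scaleR matrix_simple_root)
  have xy: "(C *v v k) $ i = x k" "(C *v v k) $ j = y k" for k
    by (simp_all add: x_def y_def)
  have x_Suc: "x (Suc k) = a * y k - x k" for k
    using mv[of k i] by (simp add: xy C_diag a_def algebra_simps)
  have y_Suc: "y (Suc k) = (a * b - 1) * y k - b * x k" for k
    using mv[of k j] by (simp add: xy C_diag a_def b_def algebra_simps)
  have v_sum: "v k = \<beta> - ((\<Sum>l<k. x l) - a * (\<Sum>l<k. y l)) *\<^sub>R simple_root i
      - (\<Sum>l<k. y l) *\<^sub>R simple_root j" for k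
  proof (induction k)
    case 0
    then show ?case by (simp add: v_def)
  next
    case (Suc k)
    then show ?case by (simp add: v_Suc algebra_simps)
  qed
  have N2: "2 \<le> N" using n_ge_2[OF False] m by (simp add: numeral_eq_enat)
  have "(\<Sum>l<N. x l) = 0 \<and> (\<Sum>l<N. y l) = 0"
  proof (cases "N = 2")
    case True
    then have "(i, j) \<notin> E" "(j, i) \<notin> E"
      using adjacent_iff[OF False] E_sym m by (auto simp: numeral_eq_enat sym_def)
    then have "a = 0" "b = 0" using False C_nonadjacent by (auto simp: a_def b_def)
    then show ?thesis using True x_Suc[of 0] y_Suc[of 0] by (simp add: numeral_2_eq_2)
  next
    case N: False
    then have "(i, j) \<in> E" using adjacent_iff[OF False] m N2 by (simp add: numeral_eq_enat)
    then have ab: "a * b = 4 * (cos (pi / real N))\<^sup>2"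
      using C_finite m by (simp add: a_def b_def)
    define \<phi> where "\<phi> = 2 * pi / real N"
    have "cos \<phi> = 2 * (cos (pi / real N))\<^sup>2 - 1"
      using cos_double_cos[of "pi / real N"] by (simp add: \<phi>_def)
    then have t: "2 * cos \<phi> = a * b - 2" using ab by simp
    have N3: "real N \<ge> 3" using N N2 by simp
    have bounds: "0 < \<phi>" "\<phi> < pi"
      using N3 by (simp_all add: \<phi>_def divide_less_eq mult.commute)
    have s: "sin (\<phi> / 2) \<noteq> 0" "sin \<phi> \<noteq> 0"
      using bounds sin_gt_zero[of "\<phi> / 2"] sin_gt_zero[of \<phi>] by auto
    have per: "real N * \<phi> = 2 * pi" using N2 by (simp add: \<phi>_def)
    have "x (Suc (Suc k)) = 2 * cos \<phi> * x (Suc k) - x k" for k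
      unfolding t x_Suc y_Suc by (simp add: algebra_simps)
    moreover have "y (Suc (Suc k)) = 2 * cos \<phi> * y (Suc k) - y k" for k
      unfolding t x_Suc y_Suc by (simp add: algebra_simps)
    ultimately show ?thesis
      using sum_recurrence_full_period[of x, OF _ per s]
        sum_recurrence_full_period[of y, OF _ per s] by blast
  qed
  then show ?thesis using v_sum[of N] by (simp add: v_def)
qed

lemma (in coxeter_matrix) word_action_cong:
  "coxeter_eq n u w \<Longrightarrow> word_action C u = word_action C w"
  by (induction rule: coxeter_eq.induct) (auto simp: fun_eq_iff word_action_relation)

lemma (in coxeter_matrix) coxeter_action_class:
  "coxeter_action C (coxeter_rel n `` {u}) = word_action C u"
proof -
  have "u \<in> coxeter_rel n `` {u}" by (simp add: coxeter_rel_def coxeter_eq.refl)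
  then have "(SOME w. w \<in> coxeter_rel n `` {u}) \<in> coxeter_rel n `` {u}"
    by (rule someI)
  then show ?thesis
    unfolding coxeter_action_def
    by (intro word_action_cong) (auto simp: coxeter_rel_def intro: coxeter_eq.sym)
qed

theorem (in coxeter_matrix) group_action_coxeter:
  "group_action (coxeter_group n) UNIV (coxeter_action C)"
proof -
  have bij: "word_action C u \<in> Bij UNIV" for u
  proof -
    have "coxeter_eq n (u @ rev u) []" using coxeter_eq_rev[of "rev u"] by simp
    then have "word_action C (rev u) (word_action C u \<beta>) = \<beta>"
      "word_action C u (word_action C (rev u) \<beta>) = \<beta>" for \<beta>
      using word_action_cong[OF coxeter_eq_rev[of u]] word_action_cong[of "u @ rev u" "[]"]
      by (metis word_action_simps(1,3))+
    then have "bij (word_action C u)" by (intro o_bij[of "word_action C (rev u)"]) auto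
    then show ?thesis by (simp add: Bij_def)
  qed
  have "coxeter_action C \<in> hom (coxeter_group n) (BijGroup UNIV)"
  proof (rule homI)
    fix X assume "X \<in> carrier (coxeter_group n)"
    then obtain u where "X = coxeter_rel n `` {u}"
      unfolding coxeter_group_carrier by metis
    then show "coxeter_action C X \<in> carrier (BijGroup UNIV)"
      by (simp only: coxeter_action_class) (simp add: BijGroup_def bij)
  next
    fix X Y assume "X \<in> carrier (coxeter_group n)" "Y \<in> carrier (coxeter_group n)"
    then obtain u w where "X = coxeter_rel n `` {u}" "Y = coxeter_rel n `` {w}"
      unfolding coxeter_group_carrier by metis
    then show "coxeter_action C (X \<otimes>\<^bsub>coxeter_group n\<^esub> Y)
        = coxeter_action C X \<otimes>\<^bsub>BijGroup UNIV\<^esub> coxeter_action C Y"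
      by (simp only: coxeter_group_mult coxeter_action_class)
        (simp add: BijGroup_def bij compose_def fun_eq_iff)
  qed
  then show ?thesis
    unfolding group_action_def group_hom_def group_hom_axioms_def
    using group_coxeter_group group_BijGroup by blast
qed


section \<open>The numbers game\<close>

definition fire :: "real^'i^'i \<Rightarrow> 'i::finite \<Rightarrow> real^'i \<Rightarrow> real^'i" where
  "fire C i v = (\<chi> j. v $ j - C $ i $ j * v $ i)"

definition nonneg :: "real^'i::finite \<Rightarrow> bool" where
  "nonneg v \<longleftrightarrow> (\<forall>i. 0 \<le> v $ i)"

definition forbidden :: "real^'i::finite \<Rightarrow> bool" where
  "forbidden v \<longleftrightarrow> (\<exists>i. v $ i < -1)"

definition move :: "real^'i^'i \<Rightarrow> real^'i::finite \<Rightarrow> real^'i \<Rightarrow> bool" where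
  "move C v w \<longleftrightarrow> (\<exists>i. v $ i < 0 \<and> w = fire C i v)"

definition cutoff_move :: "real^'i^'i \<Rightarrow> real^'i::finite \<Rightarrow> real^'i \<Rightarrow> bool" where
  "cutoff_move C v w \<longleftrightarrow> \<not> forbidden v \<and> move C v w"

definition infinite_play :: "('a \<Rightarrow> 'a \<Rightarrow> bool) \<Rightarrow> 'a \<Rightarrow> (nat \<Rightarrow> 'a) \<Rightarrow> bool" where
  "infinite_play M v p \<longleftrightarrow> p 0 = v \<and> (\<forall>k. M (p k) (p (Suc k)))"

text \<open>The usual game has no move exactly at the nonnegative configurations, so it terminates,
  however it is played, if and only if it cannot be played forever.\<close>

definition terminates :: "real^'i^'i \<Rightarrow> real^'i::finite \<Rightarrow> bool" where
  "terminates C v \<longleftrightarrow> (\<nexists>p. infinite_play (move C) v p)"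

definition winning :: "real^'i^'i \<Rightarrow> real^'i::finite \<Rightarrow> bool" where
  "winning C v \<longleftrightarrow> (\<exists>w. (cutoff_move C)\<^sup>*\<^sup>* v w \<and> nonneg w)"

text \<open>Every way of playing with a cutoff ends, and the configuration at which it ends is
  forbidden.\<close>

definition losing :: "real^'i^'i \<Rightarrow> real^'i::finite \<Rightarrow> bool" where
  "losing C v \<longleftrightarrow>
    (\<nexists>p. infinite_play (cutoff_move C) v p) \<and>
    (\<forall>w. (cutoff_move C)\<^sup>*\<^sup>* v w \<and> (\<nexists>x. cutoff_move C w x) \<longrightarrow> forbidden w)"

end

theory Submission
  imports Defs
begin

text \<open>
  Firing \<open>i\<close> is dual to the reflection \<open>s\<^sub>i\<close>: the number \<open>\<beta> \<cdot> f\<^sub>i(v)\<close> equals \<open>s\<^sub>i(\<beta>) \<cdot> v\<close>. Let \<open>N(v)\<close> be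
  the set of positive roots whose product with \<open>v\<close> is negative. If \<open>v\<^sub>i < 0\<close>, then \<open>N(v)\<close> is the
  disjoint union of \<open>{\<alpha>\<^sub>i}\<close> and \<open>s\<^sub>i(N(f\<^sub>i(v)))\<close>, so a move removes the single value \<open>v\<^sub>i\<close> from the
  products of \<open>v\<close> with the elements of \<open>N(v)\<close>, and \<open>N(v)\<close> is empty when \<open>v\<close> is nonnegative. Hence
  a play that reaches a nonnegative configuration shows that \<open>N(v)\<close> is finite, which bounds the
  length of every play, and that the products are exactly the numbers fired on.

  The two facts needed about roots are that each of them is nonnegative or nonpositive, and that
  a positive multiple of a simple root is a root only if it is that simple root. Both follow by one
  induction on the length of a reduced word, which splits off a maximal final factor in two
  generators and so reduces to dihedral groups. There the coordinates are Chebyshev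
  values, and the condition on odd \<open>n\<^sub>i\<^sub>j\<close> is what makes the longest element map \<open>\<alpha>\<^sub>i\<close> to \<open>- \<alpha>\<^sub>j\<close>
  without a scaling factor.
\<close>

section \<open>Reduced words\<close>

fun alternating :: "'a \<Rightarrow> 'a \<Rightarrow> nat \<Rightarrow> 'a list" where
  "alternating a b 0 = []"
| "alternating a b (Suc L) = a # alternating b a L"

lemma length_alternating [simp]: "length (alternating a b L) = L"
  by (induction L arbitrary: a b) auto

lemma alternating_add:
  "alternating a b (k + l) =
    alternating a b k @ (if even k then alternating a b l else alternating b a l)"
  by (induction k arbitrary: a b) auto

lemma concat_replicate_alternating: "concat (replicate m [a, b]) = alternating a b (2 * m)"
  by (induction m) auto

context coxeter_graph
begin

definition reduced :: "'i list \<Rightarrow> bool" where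
  "reduced u \<longleftrightarrow> (\<forall>w. coxeter_eq n u w \<longrightarrow> length u \<le> length w)"

lemma coxeter_eq_double: "coxeter_eq n (u @ [i, i] @ w) (u @ w)"
  using coxeter_eq.rel[of n i i 1 u w] n_diag[of i] by (simp add: one_enat_def)

text \<open>Relators have even length, so length parity is the sign character.\<close>

lemma coxeter_eq_even_length: "coxeter_eq n u w \<Longrightarrow> even (length u) \<longleftrightarrow> even (length w)"
  by (induction rule: coxeter_eq.induct) (auto simp: concat_replicate_alternating)

lemma coxeter_eq_cancel_right:
  assumes "coxeter_eq n (p @ q) w"
  shows "coxeter_eq n p (w @ rev q)"
proof -
  have "coxeter_eq n (q @ rev q) []"
    using coxeter_eq_rev[of "rev q"] by simp
  from coxeter_eq_append[OF this, of p "[]"] have "coxeter_eq n p (p @ q @ rev q)"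
    by (simp add: coxeter_eq.sym)
  also have "coxeter_eq n (p @ q @ rev q) (w @ rev q)"
    using coxeter_eq_append[OF assms, of "[]" "rev q"] by simp
  finally (coxeter_eq.trans) show ?thesis .
qed

lemma reduced_cong:
  assumes "reduced u" "coxeter_eq n u w" "length w \<le> length u"
  shows "reduced w"
  using assms unfolding reduced_def by (meson coxeter_eq.trans le_trans)

lemma reduced_infix:
  assumes "reduced (x @ u @ y)"
  shows "reduced u"
  unfolding reduced_def
proof (intro allI impI)
  fix w assume "coxeter_eq n u w"
  then have "length (x @ u @ y) \<le> length (x @ w @ y)"
    using assms coxeter_eq_append unfolding reduced_def by blast
  then show "length u \<le> length w" by simp
qed

lemma ex_reduced: "\<exists>w. coxeter_eq n u w \<and> reduced w"
proof -
  obtain w where w: "coxeter_eq n u w" "\<And>x. coxeter_eq n u x \<Longrightarrow> length w \<le> length x"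
    using ex_has_least_nat[of "coxeter_eq n u" u length] coxeter_eq.refl by metis
  then have "reduced w" unfolding reduced_def by (meson coxeter_eq.trans)
  with w show ?thesis by blast
qed

text \<open>By parity a word shorter than \<open>u @ [i]\<close> for the same element cannot be as
  long as \<open>u\<close>. Moving \<open>i\<close> across then does the work of the exchange
  condition.\<close>

lemma not_reduced_snoc:
  assumes "\<not> reduced (u @ [i])"
  obtains w where "coxeter_eq n u (w @ [i])" "length w < length u"
proof -
  obtain w where w: "coxeter_eq n (u @ [i]) w" "length w < length (u @ [i])"
    using assms unfolding reduced_def by (meson not_le)
  then have "length w \<noteq> length u"
    using coxeter_eq_even_length[OF w(1)] by auto
  then show ?thesis using that coxeter_eq_cancel_right[OF w(1)] w(2) by simp
qed

lemma not_reduced_repeat: "\<not> reduced (i # i # u)"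
  using coxeter_eq_double[of "[]" i u] unfolding reduced_def by force

text \<open>In the relator of length \<open>2 * m\<close>, the first \<open>m + 1\<close> letters
  equal the inverse of the last \<open>m - 1\<close>, a shorter word.\<close>

lemma reduced_alternating_le:
  assumes "reduced (alternating a b L)" "n a b = enat m" "a \<noteq> b"
  shows "L \<le> m"
proof (rule ccontr)
  assume "\<not> L \<le> m"
  then obtain l where "L = Suc m + l" by (metis not_less_eq_eq le_iff_add)
  then have "reduced ([] @ alternating a b (Suc m) @
      (if even (Suc m) then alternating a b l else alternating b a l))"
    using assms(1) alternating_add[of a b "Suc m" l] by simp
  then have red: "reduced (alternating a b (Suc m))" by (rule reduced_infix)
  have m: "1 \<le> m" using n_ge_2[OF assms(3)] assms(2) by (simp add: numeral_eq_enat)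
  define q where "q = (if even (Suc m) then alternating a b (m - 1) else alternating b a (m - 1))"
  have "alternating a b (2 * m) = alternating a b (Suc m) @ q"
    using alternating_add[of a b "Suc m" "m - 1"] m by (simp add: q_def mult_2)
  then have "coxeter_eq n (alternating a b (Suc m) @ q) []"
    using coxeter_eq.rel[of n a b m "[]" "[]"] assms(2)
    by (simp add: concat_replicate_alternating)
  from coxeter_eq_cancel_right[OF this] red have "Suc m \<le> length q"
    unfolding reduced_def by fastforce
  then show False by (simp add: q_def split: if_splits)
qed

end

section \<open>Dihedral coefficients\<close>

text \<open>\<open>cheb (2 * x) (Suc l)\<close> is the value at \<open>x\<close> of the Chebyshev polynomial \<open>U\<^sub>l\<close> of the
  second kind.\<close>

fun cheb :: "real \<Rightarrow> nat \<Rightarrow> real" where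
  "cheb q 0 = 0"
| "cheb q (Suc 0) = 1"
| "cheb q (Suc (Suc l)) = q * cheb q (Suc l) - cheb q l"

lemma sin_mult_cheb: "sin t * cheb (2 * cos t) l = sin (real l * t)"
proof (induction l rule: induct_nat_012)
  case (ge2 l)
  have "sin (real (Suc (Suc l)) * t) + sin (real l * t) = 2 * cos t * sin (real (Suc l) * t)"
    using sin_add[of "real (Suc l) * t" t] sin_diff[of "real (Suc l) * t" t]
    by (simp add: algebra_simps)
  moreover have "sin t * cheb (2 * cos t) (Suc (Suc l)) =
      2 * cos t * (sin t * cheb (2 * cos t) (Suc l)) - sin t * cheb (2 * cos t) l"
    by (simp add: algebra_simps)
  ultimately show ?case unfolding ge2.IH by simp
qed auto

text \<open>For infinite bonds. Growth by at least 1 is included because q \<ge> 2 keeps the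
  increments from shrinking, which closes the induction.\<close>

lemma cheb_increasing:
  assumes "2 \<le> q"
  shows "0 \<le> cheb q l \<and> cheb q l + 1 \<le> cheb q (Suc l)"
proof (induction l)
  case (Suc l)
  then have IH: "0 \<le> cheb q l" "cheb q l + 1 \<le> cheb q (Suc l)" by auto
  then have "2 * cheb q (Suc l) \<le> q * cheb q (Suc l)"
    using assms by (intro mult_right_mono) auto
  with IH show ?case unfolding cheb.simps by linarith
qed simp

text \<open>For finite bonds. With t = pi / m the values are sin (l t) / sin t.\<close>

lemma cheb_cos_pi:
  assumes "2 \<le> m"
  defines "q \<equiv> 2 * cos (pi / real m)"
  shows "0 < l \<Longrightarrow> l < m \<Longrightarrow> 0 < cheb q l" "cheb q m = 0" "cheb q (m - 1) = 1"
proof -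
  define t where "t = pi / real m"
  have mt: "real m * t = pi" using assms(1) by (simp add: t_def)
  have t: "0 < t" "t < pi" using assms(1) by (simp_all add: t_def divide_less_eq)
  then have s: "0 < sin t" by (rule sin_gt_zero)
  have eq: "cheb q l = sin (real l * t) / sin t" for l
    using sin_mult_cheb[of t l] s unfolding q_def t_def by (simp add: field_simps)
  show "0 < cheb q l" if "0 < l" "l < m"
  proof -
    have "real l * t < real m * t" using that t by simp
    then have "0 < sin (real l * t)" using that t mt by (intro sin_gt_zero) auto
    then show ?thesis using s by (simp add: eq)
  qed
  show "cheb q m = 0" by (simp add: eq mt)
  have "real (m - 1) * t = pi - t"
    using mt assms(1) by (simp add: of_nat_diff algebra_simps)
  then show "cheb q (m - 1) = 1" using s by (simp add: eq)
qed

section \<open>Sign and primitivity of roots\<close>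

context coxeter_matrix
begin

lemma simple_root_nth: "simple_root i $ j = (if j = i then 1 else 0)"
  by (simp add: simple_root_def axis_def)

lemma simple_reflection_lincomb:
  assumes "i \<noteq> k"
  shows "simple_reflection C k (x *\<^sub>R simple_root i + y *\<^sub>R simple_root k) =
    x *\<^sub>R simple_root i + (- y - C $ k $ i * x) *\<^sub>R simple_root k"
  by (simp add: vec_eq_iff simple_root_nth simple_reflection_eq matrix_vector_right_distrib
      matrix_vector_mult_scaleR matrix_simple_root C_diag algebra_simps)

lemma linear_simple_reflection: "linear (simple_reflection C i)"
  by (rule linearI)
    (simp_all add: simple_reflection_eq matrix_vector_right_distrib matrix_vector_mult_scaleR
      algebra_simps)

lemma linear_word_action: "linear (word_action C u)"
proof (induction u)
  case Nil
  show ?case by (rule linearI) simp_all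
next
  case (Cons i u)
  then show ?case
    using linear_compose[OF Cons linear_simple_reflection[of i]] by (simp add: o_def)
qed

lemma simple_reflection_involution [simp]:
  "simple_reflection C i (simple_reflection C i \<beta>) = \<beta>"
  using word_action_cong[OF coxeter_eq_double[of "[]" i "[]"]] by (simp add: fun_eq_iff)

lemma simple_reflection_simple_root [simp]:
  "simple_reflection C i (simple_root i) = - simple_root i"
  by (simp add: simple_reflection_eq matrix_simple_root C_diag scaleR_2)

lemma word_action_rev [simp]: "word_action C (rev u) (word_action C u \<beta>) = \<beta>"
  using word_action_cong[OF coxeter_eq_rev[of u]] by (simp add: fun_eq_iff)

lemma roots_iff: "\<beta> \<in> roots n C \<longleftrightarrow> (\<exists>u i. \<beta> = word_action C u (simple_root i))"
proof -
  have "orbit (coxeter_group n) (coxeter_action C) x = range (\<lambda>u. word_action C u x)" for x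
    unfolding orbit_def using coxeter_group_carrier[of _ n]
    by (auto simp: coxeter_action_class) (metis coxeter_action_class)
  then show ?thesis by (auto simp: roots_def)
qed

section \<open>Rank-two subgroups\<close>

text \<open>The action of \<open>s\<^sub>i\<close> and \<open>s\<^sub>k\<close> on the coordinates \<open>x\<close>, \<open>r * y\<close> of \<open>x \<alpha>\<^sub>i + y \<alpha>\<^sub>k\<close> is symmetric.\<close>

lemma dihedral_parameters:
  assumes "i \<noteq> k"
  obtains q r where "0 < r" "C $ i $ k = - q * r" "C $ k $ i = - q / r"
    "\<And>l. 0 < l \<Longrightarrow> enat l < n i k \<Longrightarrow> 0 < cheb q l"
    "\<And>m. n i k = enat m \<Longrightarrow> cheb q m = 0 \<and> cheb q (m - 1) = 1"
    "C $ i $ k = C $ k $ i \<Longrightarrow> r = 1"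
proof (cases "(i, k) \<in> E")
  case False
  then have "(k, i) \<notin> E" using E_sym by (auto simp: sym_def)
  then have C0: "C $ i $ k = 0" "C $ k $ i = 0" using C_nonadjacent assms False by auto
  have "n i k = enat 2"
  proof (cases "n i k")
    case (enat m)
    then show ?thesis using n_ge_2[OF assms] adjacent_iff[OF assms] False
      by (simp add: numeral_eq_enat)
  next
    case infinity
    then show ?thesis using adjacent_iff[OF assms] False by simp
  qed
  \<comment> \<open>For commuting generators q = 2 cos (pi / 2) = 0; both entries vanish, so r = 1
    can be chosen.\<close>
  then show ?thesis using cheb_cos_pi[of 2] C0
    by (intro that[of 1 0]) auto
next
  case True
  then have "(k, i) \<in> E" using E_sym by (auto simp: sym_def)
  then have neg: "C $ i $ k < 0" "C $ k $ i < 0" using C_adjacent True by auto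
  define q where "q = sqrt (C $ i $ k * C $ k $ i)"
  define r where "r = sqrt (C $ i $ k / C $ k $ i)"
  have r: "0 < r" using neg by (simp add: r_def divide_neg_neg)
  have ik: "C $ i $ k = - q * r"
  proof -
    have "q * r = sqrt ((C $ i $ k)\<^sup>2)"
      unfolding q_def r_def real_sqrt_mult[symmetric]
      using neg by (simp add: power2_eq_square)
    then show ?thesis using neg by simp
  qed
  have ki: "C $ k $ i = - q / r"
  proof -
    have "q / r = sqrt ((C $ k $ i)\<^sup>2)"
      unfolding q_def r_def real_sqrt_divide[symmetric]
      using neg by (simp add: power2_eq_square)
    then show ?thesis using neg by simp
  qed
  have r1: "r = 1" if "C $ i $ k = C $ k $ i"
    using that neg by (simp add: r_def)
  show ?thesis
  proof (cases "n i k")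
    case (enat m)
    have m: "3 \<le> m" using True adjacent_iff[OF assms] enat by (simp add: numeral_eq_enat)
    then have "0 \<le> cos (pi / real m)"
      by (intro cos_ge_zero) (auto simp: field_simps intro: order_trans[of _ 0])
    then have "q = 2 * cos (pi / real m)"
      using C_finite[OF True enat] by (simp add: q_def real_sqrt_mult)
    then have "0 < cheb q l" if "0 < l" "enat l < n i k" for l
      using that cheb_cos_pi(1)[of m l] m enat by simp
    moreover have "cheb q m' = 0 \<and> cheb q (m' - 1) = 1" if "n i k = enat m'" for m'
      using that cheb_cos_pi(2,3)[of m] m enat \<open>q = 2 * cos (pi / real m)\<close> by simp
    ultimately show ?thesis using that[of r q] r ik ki r1 by blast
  next
    case infinity
    have "sqrt 4 \<le> q" using C_infinite[OF True infinity] by (simp only: q_def real_sqrt_le_iff)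
    then have q: "2 \<le> q" by simp
    have "0 < cheb q l" if l: "0 < l" for l
    proof -
      have "0 \<le> cheb q (l - 1)" "cheb q (l - 1) + 1 \<le> cheb q l"
        using cheb_increasing[OF q, of "l - 1"] l by auto
      then show ?thesis by linarith
    qed
    moreover have "cheb q m = 0 \<and> cheb q (m - 1) = 1" if "n i k = enat m" for m
      using that infinity by simp
    ultimately show ?thesis using that[of r q] r ik ki r1 by blast
  qed
qed

text \<open>Reducedness forces each prepended letter to be the other generator, and its reflection
  replaces one coordinate by the next term of the Chebyshev recurrence.\<close>

lemma dihedral_word_action:
  assumes ik: "i \<noteq> k" and r: "0 < r" "C $ i $ k = - q * r" "C $ k $ i = - q / r"
  assumes "set d \<subseteq> {i, k}" "reduced (d @ [i])"
  defines "L \<equiv> length d"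
  shows "d @ [i] = (if even L then alternating i k (Suc L) else alternating k i (Suc L)) \<and>
    word_action C d (simple_root i) =
      (if even L then cheb q (Suc L) *\<^sub>R simple_root i + (cheb q L / r) *\<^sub>R simple_root k
       else cheb q L *\<^sub>R simple_root i + (cheb q (Suc L) / r) *\<^sub>R simple_root k)"
  using assms(5,6) unfolding L_def
proof (induction d)
  case Nil
  show ?case by simp
next
  case (Cons c d)
  have red: "reduced (d @ [i])"
    using Cons.prems(2) reduced_infix[of "[c]" "d @ [i]" "[]"] by simp
  show ?case
  proof (cases "even (length d)")
    case True
    with Cons red have d: "d @ [i] = alternating i k (Suc (length d))"
      "word_action C d (simple_root i) =
        cheb q (Suc (length d)) *\<^sub>R simple_root i + (cheb q (length d) / r) *\<^sub>R simple_root k"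
      by auto
    then have "c \<noteq> i" using Cons.prems(2) not_reduced_repeat by (auto simp del: append_assoc)
    then have "c = k" using Cons.prems(1) by simp
    then show ?thesis using True d r
      by (simp add: simple_reflection_lincomb[OF ik] diff_divide_distrib)
  next
    case False
    with Cons red have d: "d @ [i] = alternating k i (Suc (length d))"
      "word_action C d (simple_root i) =
        cheb q (length d) *\<^sub>R simple_root i + (cheb q (Suc (length d)) / r) *\<^sub>R simple_root k"
      by auto
    then have "c \<noteq> k" using Cons.prems(2) not_reduced_repeat by (auto simp del: append_assoc)
    then have c: "c = i" using Cons.prems(1) by simp
    have "simple_reflection C i (x *\<^sub>R simple_root i + y *\<^sub>R simple_root k) =
        (- x - C $ i $ k * y) *\<^sub>R simple_root i + y *\<^sub>R simple_root k" for x y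
      using simple_reflection_lincomb[OF ik[symmetric], of y x] by (simp add: add.commute)
    then show ?thesis using False d r unfolding c by simp
  qed
qed

end

locale odd_symmetric_coxeter_matrix = coxeter_matrix +
  assumes C_odd: "n i j = enat m \<Longrightarrow> odd m \<Longrightarrow> C $ i $ j = C $ j $ i"
begin

text \<open>A reduced alternating word has length at most \<open>n i k\<close>, the range where the
  Chebyshev values are nonnegative. A coordinate vanishes only at the ends \<open>L = 0\<close> and
  \<open>Suc L = n i k\<close>, where the other one is 1.\<close>

lemma dihedral_root:
  assumes "i \<noteq> k" "set d \<subseteq> {i, k}" "reduced (d @ [i])"
  obtains x y where "word_action C d (simple_root i) = x *\<^sub>R simple_root i + y *\<^sub>R simple_root k"
    "0 \<le> x" "0 \<le> y" "x = 0 \<Longrightarrow> y = 1" "y = 0 \<Longrightarrow> x = 1"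
proof (rule dihedral_parameters[OF assms(1)])
  fix q r assume r: "0 < r" "C $ i $ k = - q * r" "C $ k $ i = - q / r"
    and pos: "\<And>l. 0 < l \<Longrightarrow> enat l < n i k \<Longrightarrow> 0 < cheb q l"
    and vanish: "\<And>m. n i k = enat m \<Longrightarrow> cheb q m = 0 \<and> cheb q (m - 1) = 1"
    and r1: "C $ i $ k = C $ k $ i \<Longrightarrow> r = 1"
  define L where "L = length d"
  note act = dihedral_word_action[OF assms(1) r assms(2,3), folded L_def]
  have le: "enat (Suc L) \<le> n i k"
  proof (cases "n i k")
    case (enat m)
    have ki: "n k i = enat m" using enat n_sym[of k i] by metis
    have "reduced (if even L then alternating i k (Suc L) else alternating k i (Suc L))"
      using assms(3) unfolding conjunct1[OF act] .
    then have "Suc L \<le> m"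
      using reduced_alternating_le[OF _ enat assms(1)]
        reduced_alternating_le[OF _ ki assms(1)[symmetric]]
      by (cases "even L") (simp_all del: alternating.simps)
    then show ?thesis using enat by simp
  qed simp
  have L: "0 < cheb q L" if "L \<noteq> 0"
    using that pos le by (simp add: Suc_ile_eq)
  \<comment> \<open>At the far end the surviving coordinate for even \<open>L\<close> is
    \<open>cheb q L / r\<close>; there \<open>n i k\<close> is odd, so symmetry of the entries gives
    \<open>r = 1\<close>. For odd \<open>L\<close> it carries no \<open>r\<close>.\<close>
  have Suc_L: "0 < cheb q (Suc L) \<or>
      (cheb q (Suc L) = 0 \<and> cheb q L = 1 \<and> (even L \<longrightarrow> r = 1))"
  proof (cases "n i k = enat (Suc L)")
    case True
    then show ?thesis using vanish[OF True] C_odd[OF True] r1 by simp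
  next
    case False
    then show ?thesis using pos le by simp
  qed
  show ?thesis
  proof (cases "even L")
    case True
    have act': "word_action C d (simple_root i) =
        cheb q (Suc L) *\<^sub>R simple_root i + (cheb q L / r) *\<^sub>R simple_root k"
      using conjunct2[OF act] by (simp only: True if_True)
    have x: "0 \<le> cheb q (Suc L)" using Suc_L by auto
    have y: "0 \<le> cheb q L / r" using L r(1) by (cases "L = 0") auto
    have "cheb q L / r = 1" if "cheb q (Suc L) = 0"
      using that Suc_L True by auto
    moreover have "cheb q (Suc L) = 1" if "cheb q L / r = 0"
      using that L r(1) by (cases "L = 0") auto
    ultimately show ?thesis using that[OF act' x y] by blast
  next
    case False
    have act': "word_action C d (simple_root i) =
        cheb q L *\<^sub>R simple_root i + (cheb q (Suc L) / r) *\<^sub>R simple_root k"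
      using conjunct2[OF act] by (simp only: False if_False)
    have pos_L: "0 < cheb q L" using False by (intro L) (metis even_zero)
    then have x: "0 \<le> cheb q L" by simp
    have y: "0 \<le> cheb q (Suc L) / r" using Suc_L r(1) by auto
    have "cheb q L = 1" if "cheb q (Suc L) / r = 0"
      using that Suc_L r(1) by auto
    moreover have "cheb q L \<noteq> 0" using pos_L by simp
    ultimately show ?thesis using that[OF act' x y] by blast
  qed
qed

text \<open>The root is a nonnegative combination of two roots covered by induction. If one
  coefficient vanishes, the other is 1 and the scalar claim is inherited; otherwise the root is no
  multiple of a simple root.\<close>

lemma reduced_root:
  assumes "reduced (u @ [i])"
  shows "nonneg (word_action C u (simple_root i)) \<and>
    (\<forall>c j. word_action C u (simple_root i) = c *\<^sub>R simple_root j \<longrightarrow> c = 1)"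
  using assms
proof (induction "length u" arbitrary: u i rule: less_induct)
  case less
  show ?case
  proof (cases u rule: rev_cases)
    case Nil
    have "c = 1" if "simple_root i = c *\<^sub>R simple_root j" for c j
      using arg_cong[OF that, of "\<lambda>x. x $ i"] by (auto simp: simple_root_nth split: if_splits)
    then show ?thesis using Nil by (auto simp: nonneg_def simple_root_nth)
  next
    case (snoc u' k)
    have red_u: "reduced u" using less.prems reduced_infix[of "[]" u "[i]"] by simp
    have ik: "i \<noteq> k"
    proof
      assume "i = k"
      then have "reduced (i # i # [])"
        using less.prems reduced_infix[of u' "[i, i]" "[]"] snoc by simp
      then show False using not_reduced_repeat by blast
    qed
    \<comment> \<open>A shortest such \<open>v\<close> represents the coset of \<open>u\<close>
      modulo the subgroup generated by \<open>i\<close> and \<open>k\<close>; lengths add so that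
      \<open>v @ d\<close> stays reduced.\<close>
    define P where "P v \<longleftrightarrow> (\<exists>d. coxeter_eq n u (v @ d) \<and> set d \<subseteq> {i, k} \<and>
      length v + length d = length u)" for v
    have "P u'" unfolding P_def using snoc by (auto intro!: exI[of _ "[k]"] coxeter_eq.refl)
    then obtain v where v: "P v" "\<And>x. P x \<Longrightarrow> length v \<le> length x"
      using ex_has_least_nat[of P u' length] by metis
    then obtain d where d: "coxeter_eq n u (v @ d)" "set d \<subseteq> {i, k}"
      "length v + length d = length u" unfolding P_def by blast
    have short: "length v < length u" using v(2)[OF \<open>P u'\<close>] snoc by simp
    have red_v: "reduced (v @ [j])" if j: "j \<in> {i, k}" for j
    proof (rule ccontr)
      \<comment> \<open>Then a letter \<open>j\<close> moves from \<open>v\<close> into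
        \<open>d\<close>. Reducedness of \<open>u\<close> keeps the lengths additive, contradicting
        the choice of \<open>v\<close>.\<close>
      assume "\<not> reduced (v @ [j])"
      then obtain w where w: "coxeter_eq n v (w @ [j])" "length w < length v"
        by (rule not_reduced_snoc)
      have eq: "coxeter_eq n u (w @ j # d)"
        using coxeter_eq.trans[OF d(1) coxeter_eq_append[OF w(1), of "[]" d, simplified]] .
      then have "length u \<le> length (w @ j # d)"
        using red_u unfolding reduced_def by blast
      then have "P w" unfolding P_def using eq d(2,3) w(2) j
        by (intro exI[of _ "j # d"]) auto
      then show False using v(2) w(2) by fastforce
    qed
    note IH = less.hyps[OF short red_v]
    have "reduced (v @ d @ [i])"
      using reduced_cong[OF less.prems] coxeter_eq_append[OF d(1), of "[]" "[i]"] d(3) by simp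
    then have "reduced (d @ [i])" using reduced_infix[of v "d @ [i]" "[]"] by simp
    then obtain x y where xy:
      "word_action C d (simple_root i) = x *\<^sub>R simple_root i + y *\<^sub>R simple_root k"
      "0 \<le> x" "0 \<le> y" "x = 0 \<Longrightarrow> y = 1" "y = 0 \<Longrightarrow> x = 1"
      using dihedral_root[OF ik d(2)] by blast
    define a where "a = word_action C v (simple_root i)"
    define b where "b = word_action C v (simple_root k)"
    have ab: "nonneg a" "nonneg b" using IH[of i] IH[of k] by (auto simp: a_def b_def)
    have u_eq: "word_action C u (simple_root i) = x *\<^sub>R a + y *\<^sub>R b"
      using word_action_cong[OF d(1)] xy(1) linear_word_action[of v]
      by (simp add: linear_add linear_scale a_def b_def)
    moreover have "nonneg (x *\<^sub>R a + y *\<^sub>R b)" using ab xy(2,3) by (simp add: nonneg_def)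
    moreover have "c = 1" if c: "x *\<^sub>R a + y *\<^sub>R b = c *\<^sub>R simple_root j" for c j
    proof (cases "x = 0 \<or> y = 0")
      case True
      then have "a = c *\<^sub>R simple_root j \<or> b = c *\<^sub>R simple_root j" using c xy(4,5) by auto
      then show ?thesis using IH[of i] IH[of k] by (auto simp: a_def b_def)
    next
      case False
      then have xy0: "0 < x" "0 < y" using xy(2,3) by auto
      have zero: "a $ l = 0 \<and> b $ l = 0" if "l \<noteq> j" for l
      proof -
        have "x * a $ l + y * b $ l = 0"
          using arg_cong[OF c, of "\<lambda>z. z $ l"] that by (simp add: simple_root_nth)
        moreover have "0 \<le> x * a $ l" "0 \<le> y * b $ l"
          using ab xy0 by (auto simp: nonneg_def)
        ultimately show ?thesis using xy0 by (simp add: add_nonneg_eq_0_iff)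
      qed
      \<comment> \<open>Both vectors are supported on \<open>j\<close>, hence proportional. Undoing
        \<open>v\<close> relates two distinct simple roots, which forces
        \<open>b = 0\<close>.\<close>
      have "(b $ j) *\<^sub>R a = (a $ j) *\<^sub>R b"
        unfolding vec_eq_iff
      proof
        fix l
        show "((b $ j) *\<^sub>R a) $ l = ((a $ j) *\<^sub>R b) $ l"
          using zero[of l] by (cases "l = j") auto
      qed
      from arg_cong[OF this, of "word_action C (rev v)"]
      have "(b $ j) *\<^sub>R simple_root i = (a $ j) *\<^sub>R simple_root k"
        using linear_word_action[of "rev v"] by (simp add: linear_scale a_def b_def)
      from arg_cong[OF this, of "\<lambda>z. z $ i"] have "b $ j = 0"
        using ik by (simp add: simple_root_nth)
      then have "b $ l = 0" for l using zero[of l] by (cases "l = j") auto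
      \<comment> \<open>The inductive hypothesis with scalar 0 excludes the zero vector.\<close>
      then have "b = 0 *\<^sub>R simple_root j" by (simp add: vec_eq_iff)
      then have "(0::real) = 1" using IH[of k] unfolding b_def by blast
      then show ?thesis by simp
    qed
    ultimately show ?thesis unfolding u_eq by blast
  qed
qed

text \<open>If \<open>u @ [i]\<close> is not reduced, \<open>u\<close> may be taken to end in
  \<open>i\<close>, whose reflection negates \<open>simple_root i\<close>.\<close>

lemma root_cases:
  assumes "\<beta> \<in> roots n C"
  obtains u i where "reduced (u @ [i])" "\<beta> = word_action C u (simple_root i)"
  | u i where "reduced (u @ [i])" "\<beta> = - word_action C u (simple_root i)"
proof -
  obtain u' i where u': "\<beta> = word_action C u' (simple_root i)" using assms roots_iff by blast
  obtain u where u: "coxeter_eq n u' u" "reduced u" using ex_reduced by blast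
  have \<beta>: "\<beta> = word_action C u (simple_root i)" using u' word_action_cong[OF u(1)] by simp
  show ?thesis
  proof (cases "reduced (u @ [i])")
    case True
    then show ?thesis using that(1) \<beta> by blast
  next
    case False
    then obtain w where w: "coxeter_eq n u (w @ [i])" "length w < length u"
      by (rule not_reduced_snoc)
    then have "reduced (w @ [i])" using reduced_cong[OF u(2)] by simp
    moreover have "\<beta> = - word_action C w (simple_root i)"
      using \<beta> word_action_cong[OF w(1)] linear_word_action[of w] by (simp add: linear_neg)
    ultimately show ?thesis using that(2) by blast
  qed
qed

lemma root_nonneg_or_nonpos: "\<beta> \<in> roots n C \<Longrightarrow> nonneg \<beta> \<or> nonneg (- \<beta>)"
  by (erule root_cases) (auto dest: reduced_root)

lemma root_scaled_simple:
  assumes "c *\<^sub>R simple_root j \<in> roots n C" "0 < c"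
  shows "c = 1"
  using assms(1)
proof (cases rule: root_cases)
  case (1 u i)
  then show ?thesis using reduced_root[OF 1(1)] by metis
next
  case (2 u i)
  then have "nonneg (- (c *\<^sub>R simple_root j))" using reduced_root[OF 2(1)] by simp
  then have "c \<le> 0" unfolding nonneg_def by (auto simp: simple_root_nth dest: spec[of _ j])
  then show ?thesis using assms(2) by simp
qed

section \<open>Simple reflections on positive roots\<close>

lemma positive_roots_iff: "\<alpha> \<in> positive_roots n C \<longleftrightarrow> \<alpha> \<in> roots n C \<and> nonneg \<alpha>"
  by (simp add: positive_roots_def nonneg_def)

lemma simple_root_positive: "simple_root i \<in> positive_roots n C"
proof -
  have "simple_root i \<in> roots n C"
    unfolding roots_iff using word_action_simps(1)[of C "simple_root i"] by metis
  then show ?thesis by (simp add: positive_roots_iff nonneg_def simple_root_nth)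
qed

lemma simple_reflection_roots: "\<beta> \<in> roots n C \<Longrightarrow> simple_reflection C i \<beta> \<in> roots n C"
  by (metis roots_iff word_action_simps(2))

text \<open>The reflection alters only coordinate \<open>i\<close>; if the image is nonpositive, all
  other coordinates are 0.\<close>

lemma simple_reflection_positive:
  assumes "\<alpha> \<in> positive_roots n C"
  shows "simple_reflection C i \<alpha> \<in> positive_roots n C \<or>
    (\<exists>c\<ge>0. \<alpha> = c *\<^sub>R simple_root i)"
proof (cases "simple_reflection C i \<alpha> \<in> positive_roots n C")
  case False
  have \<alpha>: "nonneg \<alpha>" "\<alpha> \<in> roots n C" using assms by (auto simp: positive_roots_iff)
  then have "nonneg (- simple_reflection C i \<alpha>)"
    using False root_nonneg_or_nonpos[OF simple_reflection_roots[OF \<alpha>(2)]]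
    by (metis positive_roots_iff simple_reflection_roots)
  then have "\<alpha> $ j \<le> 0" if "j \<noteq> i" for j
    using that by (auto simp: nonneg_def simple_reflection_def dest: spec[of _ j])
  then have "\<alpha> = (\<alpha> $ i) *\<^sub>R simple_root i"
    using \<alpha>(1) by (auto simp: vec_eq_iff simple_root_nth nonneg_def intro: antisym)
  then show ?thesis using \<alpha>(1) by (auto simp: nonneg_def)
qed simp

section \<open>The numbers game\<close>

lemma inner_fire: "\<beta> \<bullet> fire C i v = simple_reflection C i \<beta> \<bullet> v"
proof -
  have f: "fire C i v = v - (v $ i) *\<^sub>R (C $ i)"
    by (simp add: vec_eq_iff fire_def mult.commute)
  have c: "(C *v \<beta>) $ i = \<beta> \<bullet> (C $ i)"
    by (simp add: matrix_vector_mul_component inner_commute)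
  show ?thesis
    unfolding f simple_reflection_eq c
    by (simp add: inner_diff_left inner_diff_right simple_root_def inner_axis')
qed

section \<open>Roots pairing negatively with a configuration\<close>

definition neg_roots :: "real^'a \<Rightarrow> (real^'a) set" where
  "neg_roots v = {\<alpha> \<in> positive_roots n C. \<alpha> \<bullet> v < 0}"

lemma simple_root_inner [simp]: "simple_root i \<bullet> v = v $ i"
  by (simp add: simple_root_def inner_axis')

text \<open>The reflection permutes the positive roots that are not multiples of
  \<open>simple_root i\<close> and turns products with \<open>fire C i v\<close> into products with
  \<open>v\<close>. On \<open>simple_root i\<close> the two products have opposite signs.\<close>

lemma neg_roots_fire:
  assumes "v $ i < 0"
  shows "neg_roots v = insert (simple_root i) (simple_reflection C i ` neg_roots (fire C i v))"
proof (intro Set.equalityI subsetI)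
  fix \<alpha> assume "\<alpha> \<in> neg_roots v"
  then have \<alpha>: "\<alpha> \<in> positive_roots n C" "\<alpha> \<bullet> v < 0" by (auto simp: neg_roots_def)
  from simple_reflection_positive[OF \<alpha>(1), of i]
  show "\<alpha> \<in> insert (simple_root i) (simple_reflection C i ` neg_roots (fire C i v))"
  proof
    assume "simple_reflection C i \<alpha> \<in> positive_roots n C"
    then have "simple_reflection C i \<alpha> \<in> neg_roots (fire C i v)"
      using \<alpha>(2) by (simp add: neg_roots_def inner_fire)
    then show ?thesis
      by (metis imageI insertI2 simple_reflection_involution)
  next
    assume "\<exists>c\<ge>0. \<alpha> = c *\<^sub>R simple_root i"
    then obtain c where c: "0 \<le> c" "\<alpha> = c *\<^sub>R simple_root i" by blast
    moreover have "c \<noteq> 0" using c \<alpha>(2) by auto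
    ultimately have "c = 1"
      using root_scaled_simple[of c i] \<alpha>(1) by (auto simp: positive_roots_iff)
    then show ?thesis using c by simp
  qed
next
  fix \<alpha> assume "\<alpha> \<in> insert (simple_root i) (simple_reflection C i ` neg_roots (fire C i v))"
  then show "\<alpha> \<in> neg_roots v"
  proof
    assume "\<alpha> = simple_root i"
    then show ?thesis using assms simple_root_positive by (simp add: neg_roots_def)
  next
    assume "\<alpha> \<in> simple_reflection C i ` neg_roots (fire C i v)"
    then obtain \<beta> where \<beta>: "\<alpha> = simple_reflection C i \<beta>" "\<beta> \<in> positive_roots n C"
      "\<beta> \<bullet> fire C i v < 0" by (auto simp: neg_roots_def)
    from simple_reflection_positive[OF \<beta>(2), of i] show ?thesis
    proof
      assume "simple_reflection C i \<beta> \<in> positive_roots n C"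
      then show ?thesis using \<beta> by (simp add: neg_roots_def inner_fire)
    next
      assume "\<exists>c\<ge>0. \<beta> = c *\<^sub>R simple_root i"
      then obtain c where c: "0 \<le> c" "\<beta> = c *\<^sub>R simple_root i" by blast
      have "\<beta> \<bullet> fire C i v = c * - (v $ i)"
        using c(2) by (simp add: fire_def C_diag)
      moreover have "0 \<le> c * - (v $ i)"
        using c(1) assms by (intro mult_nonneg_nonneg) auto
      ultimately show ?thesis using \<beta>(3) by simp
    qed
  qed
qed

lemma card_neg_roots_fire:
  assumes "v $ i < 0" "finite (neg_roots v)"
  shows "finite (neg_roots (fire C i v))" "card (neg_roots (fire C i v)) < card (neg_roots v)"
proof -
  let ?S = "simple_reflection C i ` neg_roots (fire C i v)"
  have inj: "inj (simple_reflection C i)" by (metis injI simple_reflection_involution)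
  have fin: "finite ?S" using assms neg_roots_fire[OF assms(1)] by simp
  then show "finite (neg_roots (fire C i v))"
    using inj finite_imageD inj_on_subset by blast
  \<comment> \<open>Otherwise \<open>- simple_root i\<close> would be a positive root. So the union
    is disjoint and a move loses exactly one root.\<close>
  have "simple_root i \<notin> ?S"
  proof
    assume "simple_root i \<in> ?S"
    then have "- simple_root i \<in> neg_roots (fire C i v)"
      by (metis imageE simple_reflection_involution simple_reflection_simple_root)
    then have "nonneg (- simple_root i)" by (simp add: neg_roots_def positive_roots_iff)
    then show False by (auto simp: nonneg_def simple_root_nth dest: spec[of _ i])
  qed
  then have "card (neg_roots v) = Suc (card ?S)"
    using fin neg_roots_fire[OF assms(1)] by simp
  moreover have "card ?S = card (neg_roots (fire C i v))"
    using inj card_image inj_on_subset by blast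
  ultimately show "card (neg_roots (fire C i v)) < card (neg_roots v)" by simp
qed

section \<open>Termination, winning and losing\<close>

lemma finite_neg_roots_terminates:
  assumes "finite (neg_roots v)"
  shows "terminates C v"
  unfolding terminates_def
proof
  assume "\<exists>p. infinite_play (move C) v p"
  then obtain p where p: "p 0 = v" "\<And>k. move C (p k) (p (Suc k))"
    by (auto simp: infinite_play_def)
  have fin: "finite (neg_roots (p k))" for k
  proof (induction k)
    case (Suc k)
    then show ?case using p(2)[of k] card_neg_roots_fire(1) by (auto simp: move_def)
  qed (simp add: p assms)
  have "card (neg_roots (p (Suc k))) < card (neg_roots (p k))" for k
    using p(2)[of k] card_neg_roots_fire(2)[OF _ fin[of k]] by (auto simp: move_def)
  then have "\<forall>k. (p (Suc k), p k) \<in> Wellfounded.measure (\<lambda>x. card (neg_roots x))" by simp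
  then show False
    using wf_measure[of "\<lambda>x. card (neg_roots x)"] unfolding wf_iff_no_infinite_down_chain by blast
qed

text \<open>Reading the play backwards, undoing a move adds one root, whose product is the number
  fired on. It is at least -1 because the configuration was allowed.\<close>

lemma winning_neg_roots:
  assumes "winning C v"
  shows "finite (neg_roots v) \<and> (\<forall>\<alpha>\<in>neg_roots v. - 1 \<le> \<alpha> \<bullet> v)"
proof -
  obtain w where "(cutoff_move C)\<^sup>*\<^sup>* v w" "nonneg w"
    using assms by (auto simp: winning_def)
  then show ?thesis
  proof (induction rule: converse_rtranclp_induct)
    case base
    have "neg_roots w = {}"
      using base by (auto simp: neg_roots_def positive_roots_iff nonneg_def inner_vec_def not_less
          intro!: sum_nonneg)
    then show ?case by simp
  next
    case (step x y)
    then obtain i where i: "x $ i < 0" "y = fire C i x" "- 1 \<le> x $ i"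
      by (auto simp: cutoff_move_def move_def forbidden_def not_less)
    show ?case unfolding neg_roots_fire[OF i(1)]
      using step.IH[OF step.prems] i by (auto simp: inner_fire)
  qed
qed

text \<open>The bound at simple roots says that the configuration is allowed, and moves preserve the
  bound. A bounded non-winning configuration thus has a successor of the same kind, which yields an
  infinite usual play.\<close>

lemma winning_if_bounded:
  assumes "terminates C v" and bound: "\<forall>\<alpha>\<in>neg_roots v. - 1 \<le> \<alpha> \<bullet> v"
  shows "winning C v"
proof (rule ccontr)
  define P where "P x \<longleftrightarrow> (\<forall>\<alpha>\<in>neg_roots x. - 1 \<le> \<alpha> \<bullet> x) \<and> \<not> winning C x" for x
  assume "\<not> winning C v"
  then have Pv: "P v" using bound by (simp add: P_def)
  have step: "\<exists>y. P y \<and> move C x y" if x: "P x" for x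
  proof -
    have "\<not> nonneg x" using x by (auto simp: P_def winning_def)
    then obtain i where i: "x $ i < 0" by (auto simp: nonneg_def not_le)
    have "\<not> forbidden x"
    proof
      assume "forbidden x"
      then obtain j where j: "x $ j < - 1" by (auto simp: forbidden_def)
      then have "simple_root j \<in> neg_roots x" by (simp add: neg_roots_def simple_root_positive)
      then show False using x j by (auto simp: P_def)
    qed
    with i have mv: "cutoff_move C x (fire C i x)" by (auto simp: cutoff_move_def move_def)
    then have "\<not> winning C (fire C i x)"
      using x by (auto simp: P_def winning_def intro: converse_rtranclp_into_rtranclp)
    moreover have "\<forall>\<alpha>\<in>neg_roots (fire C i x). - 1 \<le> \<alpha> \<bullet> fire C i x"
      using x by (auto simp: P_def neg_roots_fire[OF i] inner_fire)
    ultimately show ?thesis using mv by (auto simp: P_def cutoff_move_def)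
  qed
  \<comment> \<open>The clause for \<open>k = 0\<close> fixes the start of the play.\<close>
  have "\<exists>p. \<forall>k. (P (p k) \<and> (k = 0 \<longrightarrow> p k = v)) \<and> move C (p k) (p (Suc k))"
    by (rule dependent_nat_choice) (use Pv step in auto)
  then have "\<exists>p. infinite_play (move C) v p" by (auto simp: infinite_play_def)
  then show False using assms(1) by (simp add: terminates_def)
qed

theorem winning_iff:
  "winning C v \<longleftrightarrow> terminates C v \<and> (\<forall>\<alpha>\<in>positive_roots n C. \<alpha> \<bullet> v \<ge> - 1)"
proof -
  have "(\<forall>\<alpha>\<in>positive_roots n C. \<alpha> \<bullet> v \<ge> - 1) \<longleftrightarrow> (\<forall>\<alpha>\<in>neg_roots v. - 1 \<le> \<alpha> \<bullet> v)"
    unfolding neg_roots_def by fastforce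
  then show ?thesis
    using winning_neg_roots winning_if_bounded finite_neg_roots_terminates by blast
qed

end

text \<open>Cutoff moves are usual moves, so every play ends. Where it is stuck the configuration is
  not nonnegative, so a usual move exists and only the cutoff can block it.\<close>

lemma terminates_not_winning_losing:
  assumes "terminates C v" "\<not> winning C v"
  shows "losing C v"
  unfolding losing_def
proof (intro conjI allI impI)
  show "\<nexists>p. infinite_play (cutoff_move C) v p"
    using assms(1) by (auto simp: terminates_def infinite_play_def cutoff_move_def)
next
  fix w assume w: "(cutoff_move C)\<^sup>*\<^sup>* v w \<and> (\<nexists>x. cutoff_move C w x)"
  then have "\<not> nonneg w" using assms(2) by (auto simp: winning_def)
  then have "\<exists>x. move C w x" by (auto simp: nonneg_def move_def not_le)
  then show "forbidden w" using w by (auto simp: cutoff_move_def)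
qed

theorem corollary5p5:
  fixes E :: "('i::finite \<times> 'i) set"
    and n :: "'i \<Rightarrow> 'i \<Rightarrow> enat"
    and C :: "real^'i^'i"
    and v :: "real^'i"
  assumes "coxeter_matrix E n C"
    and "\<And>i j m. n i j = enat m \<Longrightarrow> odd m \<Longrightarrow> C $ i $ j = C $ j $ i"
  shows "(winning C v \<longleftrightarrow> terminates C v \<and> (\<forall>\<alpha>\<in>positive_roots n C. \<alpha> \<bullet> v \<ge> -1)) \<and>
    (\<not> (\<forall>\<alpha>\<in>positive_roots n C. \<alpha> \<bullet> v \<ge> -1) \<and> terminates C v \<longrightarrow> losing C v)"
proof -
  interpret coxeter_matrix E n C by (rule assms(1))
  interpret odd_symmetric_coxeter_matrix E n C by unfold_locales (rule assms(2))
  show ?thesis using winning_iff terminates_not_winning_losing by blast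
qed

end
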